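(* Let $k\in\mathbb{N}$ (with $k=0$ allowed) and $|xt|<1$. Then $$\sum_{n=0}^\infty p_{n+k}(x,y,a)\frac{t^n}{(q;q)_n}=\frac{x^k}{(xt;q)_\infty}\sum_{n=0}^\infty\frac{(q^{-k},xt,a;q)_n\,(yx^{-1}q^k)^n}{(q;q)_n}\;{}_1\Phi_1\left[\begin{array}{c}aq^n\\ 0\end{array};q;\,ytq^n\right].$$
   Context: $q$ is a fixed complex number with $0<|q|<1$; $a,x,y,t$ are complex numbers with $x\neq0$. The $q$-shifted factorials are $(a;q)_0=1$, $(a;q)_n=\prod_{i=0}^{n-1}(1-aq^i)$, $(a;q)_\infty=\prod_{i=0}^\infty(1-aq^i)$, and $(a_1,\dots,a_m;q)_n=\prod_j(a_j;q)_n$. The series ${}_1\Phi_1$ is $${}_1\Phi_1\left[\begin{array}{c}a\\ 0\end{array};q;z\right]=\sum_{n=0}^\infty(-1)^nq^{n(n-1)/2}\frac{(a;q)_n}{(q;q)_n}z^n.$$ With $\binom{n}{k}_q=\frac{(q;q)_n}{(q;q)_k(q;q)_{n-k}}$, the generalized Cauchy polynomials are $$p_n(x,y,a)=\sum_{k=0}^n\binom{n}{k}_q(-1)^kq^{k(k-1)/2}(a;q)_k\,x^{n-k}y^k.$$ *)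

theory Defs
  imports "HOL-Analysis.Analysis"
begin

definition qpoch :: "complex \<Rightarrow> complex \<Rightarrow> nat \<Rightarrow> complex" where
  "qpoch a q n = (\<Prod>i<n. 1 - a * q ^ i)"

definition qpoch_inf :: "complex \<Rightarrow> complex \<Rightarrow> complex" where
  "qpoch_inf a q = (\<Prod>i. 1 - a * q ^ i)"

definition qpochs :: "complex list \<Rightarrow> complex \<Rightarrow> nat \<Rightarrow> complex" where
  "qpochs as q n = (\<Prod>a\<leftarrow>as. qpoch a q n)"

text \<open>Only meant for \<open>k \<le> n\<close>, because of the truncated subtraction \<open>n - k\<close>.\<close>

definition qbinom :: "complex \<Rightarrow> nat \<Rightarrow> nat \<Rightarrow> complex" where
  "qbinom q n k = qpoch q q n / (qpoch q q k * qpoch q q (n - k))"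

text \<open>The series with one upper parameter \<open>a\<close> and the single lower parameter 0.\<close>

definition phi11_term :: "complex \<Rightarrow> complex \<Rightarrow> complex \<Rightarrow> nat \<Rightarrow> complex" where
  "phi11_term a q z n =
     (-1) ^ n * q ^ (n * (n - 1) div 2) * (qpoch a q n / qpoch q q n) * z ^ n"

definition phi11 :: "complex \<Rightarrow> complex \<Rightarrow> complex \<Rightarrow> complex" where
  "phi11 a q z = (\<Sum>n. phi11_term a q z n)"

definition cauchy_poly ::
  "complex \<Rightarrow> nat \<Rightarrow> complex \<Rightarrow> complex \<Rightarrow> complex \<Rightarrow> complex" where
  "cauchy_poly q n x y a =
     (\<Sum>k\<le>n. qbinom q n k * (-1) ^ k * q ^ (k * (k - 1) div 2) * qpoch a q k
             * x ^ (n - k) * y ^ k)"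

text \<open>For \<open>|q| < 1\<close> the infinite product and the series above converge, so that
  \<^const>\<open>prodinf\<close> and \<^const>\<open>suminf\<close> carry their intended meaning.\<close>

lemma convergent_prod_qpoch_inf:
  fixes a q :: complex
  assumes "norm q < 1"
  shows "convergent_prod (\<lambda>i. 1 - a * q ^ i)"
proof -
  have "summable (\<lambda>i. norm (a * q ^ i))"
    unfolding norm_mult norm_power using assms by (intro summable_mult summable_geometric) simp
  then have "summable (\<lambda>i. norm ((1 - a * q ^ i) - 1))"
    by (simp add: norm_minus_commute)
  then show ?thesis
    by (intro abs_convergent_prod_imp_convergent_prod summable_imp_abs_convergent_prod)
qed

lemma summable_phi11_term:
  assumes "norm q < 1"
  shows "summable (phi11_term a q z)"
proof -
  define r where "r n = - (q ^ n * (1 - a * q ^ n) / (1 - q * q ^ n) * z)" for n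
  have step: "phi11_term a q z (Suc n) = r n * phi11_term a q z n" for n
  proof -
    have "Suc n * (Suc n - 1) div 2 = n * (n - 1) div 2 + n"
      by (cases n) (simp_all add: algebra_simps)
    then show ?thesis
      by (simp add: phi11_term_def r_def qpoch_def power_add mult_ac)
  qed
  have "(\<lambda>n. q ^ n) \<longlonglongrightarrow> 0"
    using assms by (rule LIMSEQ_power_zero)
  then have "r \<longlonglongrightarrow> - (0 * (1 - a * 0) / (1 - q * 0) * z)"
    unfolding r_def using assms by (intro tendsto_intros) auto
  then have "(\<lambda>n. norm (r n)) \<longlonglongrightarrow> 0"
    by (simp add: tendsto_norm_zero)
  then have "\<forall>\<^sub>F n in sequentially. norm (r n) < 1 / 2"
    by (rule order_tendstoD) simp
  then obtain N where N: "\<And>n. n \<ge> N \<Longrightarrow> norm (r n) < 1 / 2"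
    by (auto simp: eventually_sequentially)
  show ?thesis
  proof (rule summable_ratio_test[where c = "1 / 2" and N = N])
    fix n assume "n \<ge> N"
    then show "norm (phi11_term a q z (Suc n)) \<le> 1 / 2 * norm (phi11_term a q z n)"
      unfolding step norm_mult using N by (intro mult_right_mono) (auto intro: less_imp_le)
  qed simp
qed

end

theory Submission
  imports Defs
begin

text \<open>
  The proof separates the shift by \<open>k\<close> from the summation over \<open>n\<close>. Put
  \<open>c\<^sub>j = (-1)\<^sup>j q\<^bsup>j(j-1)/2\<^esup> (a;q)\<^sub>j\<close>, so that the Cauchy polynomial of degree \<open>N\<close> is the
  \<open>q\<close>-binomial sum over \<open>i + j = N\<close> of \<open>c\<^sub>i y\<^sup>i x\<^sup>j\<close>.

  For \<open>N = n + k\<close>, the \<open>q\<close>-Vandermonde identity \<open>qbinom_sum_add\<close> splits this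
  polynomial into a \<open>q\<close>-binomial sum over \<open>i \<le> k\<close> of \<open>x\<^bsup>k-i\<^esup> y\<^sup>i\<close> times
  polynomials of degree \<open>n\<close> of the same kind, in which \<open>x\<close> is replaced by \<open>x q\<^sup>i\<close> and
  \<open>c\<close> by the shifted sequence \<open>c\<^sub>i\<^sub>+\<^sub>m\<close>.

  For a fixed \<open>i\<close>, multiplying by \<open>t\<^sup>n / (q;q)\<^sub>n\<close> turns the \<open>q\<close>-binomial sum into a Cauchy
  product. The generating function is thus the product of \<open>\<Sum>\<^sub>l (x t q\<^sup>i)\<^sup>l / (q;q)\<^sub>l\<close>, which
  equals \<open>1 / (x t q\<^sup>i;q)\<^sub>\<infinity> = (x t;q)\<^sub>i / (x t;q)\<^sub>\<infinity>\<close> by Euler's identity \<open>euler_identity\<close>, and of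
  \<open>\<Sum>\<^sub>m c\<^sub>i\<^sub>+\<^sub>m (y t)\<^sup>m / (q;q)\<^sub>m\<close>, which is \<open>c\<^sub>i\<close> times the \<open>\<Phi>\<close>-series with parameter
  \<open>a q\<^sup>i\<close> at \<open>y t q\<^sup>i\<close> (\<open>cauchy_coeff_add\<close>).

  Finally the \<open>q\<close>-binomial coefficient of \<open>k\<close> over \<open>i\<close>, together with the sign and the power
  of \<open>q\<close> in \<open>c\<^sub>i\<close>, is \<open>(q\<^bsup>-k\<^esup>;q)\<^sub>i q\<^bsup>ki\<^esup> / (q;q)\<^sub>i\<close> (\<open>qpoch_neg_power\<close>). As
  \<open>(q\<^bsup>-k\<^esup>;q)\<^sub>i\<close> vanishes for \<open>i > k\<close>, the finite sum over \<open>i \<le> k\<close> is the series on the right.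
\<close>

section \<open>Shifted factorials\<close>

lemma qpoch_0 [simp]: "qpoch a q 0 = 1"
  by (simp add: qpoch_def)

lemma qpoch_Suc: "qpoch a q (Suc n) = qpoch a q n * (1 - a * q ^ n)"
  by (simp add: qpoch_def)

lemma qpoch_add: "qpoch a q (m + n) = qpoch a q m * qpoch (a * q ^ m) q n"
  by (induction n) (simp_all add: qpoch_Suc power_add mult_ac)

lemma qpoch_nonzero:
  assumes "norm q < 1" "norm a < 1"
  shows "qpoch a q n \<noteq> 0"
proof -
  have "norm (a * q ^ i) < 1" for i
  proof -
    have "norm (a * q ^ i) \<le> norm a * 1"
      unfolding norm_mult norm_power using assms(1)
      by (intro mult_left_mono power_le_one) auto
    then show ?thesis using assms(2) by simp
  qed
  then have "1 - a * q ^ i \<noteq> 0" for i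
    by (metis eq_iff_diff_eq_0 norm_one order_less_irrefl)
  then show ?thesis by (simp add: qpoch_def)
qed

lemma qpoch_tendsto_qpoch_inf:
  assumes "norm q < 1"
  shows "qpoch a q \<longlonglongrightarrow> qpoch_inf a q"
proof -
  have "(\<lambda>n. \<Prod>i\<le>n. 1 - a * q ^ i) \<longlonglongrightarrow> qpoch_inf a q"
    unfolding qpoch_inf_def
    by (rule convergent_prod_LIMSEQ[OF convergent_prod_qpoch_inf[OF assms]])
  then have "(\<lambda>n. qpoch a q (Suc n)) \<longlonglongrightarrow> qpoch_inf a q"
    by (simp add: qpoch_def lessThan_Suc_atMost)
  then show ?thesis by (rule LIMSEQ_imp_Suc)
qed

lemma qpoch_inf_split:
  assumes "norm q < 1"
  shows "qpoch_inf a q = qpoch a q m * qpoch_inf (a * q ^ m) q"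
proof (rule LIMSEQ_unique)
  show "(\<lambda>n. qpoch a q (n + m)) \<longlonglongrightarrow> qpoch_inf a q"
    by (rule LIMSEQ_ignore_initial_segment[OF qpoch_tendsto_qpoch_inf[OF assms]])
  show "(\<lambda>n. qpoch a q (n + m)) \<longlonglongrightarrow> qpoch a q m * qpoch_inf (a * q ^ m) q"
    unfolding add.commute[of _ m] qpoch_add
    by (intro tendsto_mult tendsto_const qpoch_tendsto_qpoch_inf[OF assms])
qed

section \<open>Sums weighted by q-binomial coefficients\<close>

text \<open>
  The weighted function takes both \<open>i\<close> and \<open>n - i\<close> as arguments, so that recurrences in \<open>n\<close>
  involve no truncated subtraction.
\<close>

definition qbinom_sum :: "complex \<Rightarrow> nat \<Rightarrow> (nat \<Rightarrow> nat \<Rightarrow> complex) \<Rightarrow> complex" where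
  "qbinom_sum q n F = (\<Sum>i\<le>n. qbinom q n i * F i (n - i))"

lemma qbinom_sum_0 [simp]: "qbinom_sum q 0 F = F 0 0"
  by (simp add: qbinom_sum_def qbinom_def)

lemma qbinom_sum_plus:
  "qbinom_sum q n (\<lambda>i j. F i j + G i j) = qbinom_sum q n F + qbinom_sum q n G"
  by (simp add: qbinom_sum_def algebra_simps sum.distrib)

lemma qbinom_sum_cmult: "qbinom_sum q n (\<lambda>i j. b * F i j) = b * qbinom_sum q n F"
  by (simp add: qbinom_sum_def sum_distrib_left mult_ac)

text \<open>
  This is the Pascal recurrence for \<open>q\<close>-binomial coefficients. It rests on
  \<open>1 - q\<^bsup>i+j\<^esup> = (1 - q\<^sup>j) + q\<^sup>j (1 - q\<^sup>i)\<close> with \<open>i + j = n + 1\<close>: the two summands vanish at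
  \<open>j = 0\<close> and \<open>i = 0\<close> respectively, and otherwise each cancels one factor of the
  denominator.
\<close>

lemma qbinom_sum_Suc:
  assumes "norm q < 1"
  shows "qbinom_sum q (Suc n) F = qbinom_sum q n (\<lambda>i j. F i (Suc j) + q ^ j * F (Suc i) j)"
proof -
  define A where "A i = (1 - q ^ (Suc n - i)) * F i (Suc n - i)
    * qpoch q q n / (qpoch q q i * qpoch q q (Suc n - i))" for i
  define B where "B i = q ^ (Suc n - i) * (1 - q ^ i) * F i (Suc n - i)
    * qpoch q q n / (qpoch q q i * qpoch q q (Suc n - i))" for i
  have nz: "qpoch q q m \<noteq> 0" for m using qpoch_nonzero assms by blast
  have nz1: "1 - q * q ^ m \<noteq> 0" for m using nz[of "Suc m"] by (simp add: qpoch_Suc)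
  have "qbinom q (Suc n) i * F i (Suc n - i) = A i + B i" if "i \<le> Suc n" for i
  proof -
    have "q * q ^ n = q ^ (Suc n - i) * q ^ i"
      using that by (metis le_add_diff_inverse2 power_Suc power_add)
    then have "1 - q * q ^ n = (1 - q ^ (Suc n - i)) + q ^ (Suc n - i) * (1 - q ^ i)"
      by (simp add: algebra_simps)
    then show ?thesis
      unfolding A_def B_def qbinom_def qpoch_Suc
      by (simp add: add_divide_distrib[symmetric] algebra_simps)
  qed
  then have "qbinom_sum q (Suc n) F = (\<Sum>i\<le>Suc n. A i) + (\<Sum>i\<le>Suc n. B i)"
    unfolding qbinom_sum_def sum.distrib[symmetric] by (intro sum.cong) auto
  also have "(\<Sum>i\<le>Suc n. A i) = (\<Sum>i\<le>n. qbinom q n i * F i (Suc (n - i)))"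
  proof -
    have "A (Suc n) = 0" by (simp add: A_def)
    moreover have "A i = qbinom q n i * F i (Suc (n - i))" if "i \<le> n" for i
      using that nz1[of "n - i"] by (simp add: A_def qbinom_def Suc_diff_le qpoch_Suc)
    ultimately show ?thesis by simp
  qed
  also have "(\<Sum>i\<le>Suc n. B i) = (\<Sum>i\<le>n. qbinom q n i * (q ^ (n - i) * F (Suc i) (n - i)))"
  proof -
    have "B 0 = 0" by (simp add: B_def)
    moreover have "B (Suc i) = qbinom q n i * (q ^ (n - i) * F (Suc i) (n - i))" for i
      using nz1[of i] by (simp add: B_def qbinom_def qpoch_Suc)
    ultimately show ?thesis by (simp add: sum.atMost_Suc_shift del: sum.atMost_Suc)
  qed
  finally show ?thesis
    by (simp add: qbinom_sum_def sum.distrib distrib_left)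
qed

text \<open>
  The \<open>q\<close>-Vandermonde identity, in the form of a sum against an arbitrary function. The Pascal
  recurrence turns \<open>F\<close> on the left and the inner sum on the right into the same combination,
  which gives the induction on \<open>k\<close>.
\<close>

lemma qbinom_sum_add:
  assumes "norm q < 1"
  shows "qbinom_sum q (n + k) F =
    qbinom_sum q k (\<lambda>i j. qbinom_sum q n (\<lambda>m l. q ^ (i * l) * F (i + m) (j + l)))"
proof (induction k arbitrary: F)
  case 0
  then show ?case by simp
next
  case (Suc k)
  have "qbinom_sum q (n + Suc k) F = qbinom_sum q k (\<lambda>i j. qbinom_sum q n (\<lambda>m l.
      q ^ (i * l) * (F (i + m) (Suc (j + l)) + q ^ (j + l) * F (Suc (i + m)) (j + l))))"
    unfolding add_Suc_right qbinom_sum_Suc[OF assms] by (rule Suc.IH)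
  also have "\<dots> = qbinom_sum q k (\<lambda>i j.
      qbinom_sum q n (\<lambda>m l. q ^ (i * l) * F (i + m) (Suc j + l)) +
      q ^ j * qbinom_sum q n (\<lambda>m l. q ^ (Suc i * l) * F (Suc i + m) (j + l)))"
    unfolding qbinom_sum_cmult[symmetric] qbinom_sum_plus[symmetric]
    by (simp add: distrib_left power_add mult_ac)
  finally show ?case unfolding qbinom_sum_Suc[OF assms] .
qed

text \<open>
  Dividing by \<open>(q;q)\<^sub>n\<close> turns a \<open>q\<close>-binomial sum into a Cauchy product, so generating functions
  over \<open>t\<^sup>n / (q;q)\<^sub>n\<close> are multiplicative.
\<close>

lemma qbinom_sum_product_sums:
  assumes "norm q < 1"
    and "summable (\<lambda>m. norm (u m / qpoch q q m))" "summable (\<lambda>l. norm (v l / qpoch q q l))"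
  shows "(\<lambda>n. qbinom_sum q n (\<lambda>m l. u m * v l) / qpoch q q n) sums
    ((\<Sum>m. u m / qpoch q q m) * (\<Sum>l. v l / qpoch q q l))"
proof -
  have "qpoch q q n \<noteq> 0" for n using qpoch_nonzero assms by blast
  then have "qbinom_sum q n (\<lambda>m l. u m * v l) / qpoch q q n =
      (\<Sum>m\<le>n. u m / qpoch q q m * (v (n - m) / qpoch q q (n - m)))" for n
    unfolding qbinom_sum_def qbinom_def sum_divide_distrib by (intro sum.cong) auto
  then show ?thesis using Cauchy_product_sums[OF assms(2,3)] by simp
qed

section \<open>Euler's identity\<close>

lemma euler_summable_norm:
  assumes "norm q < 1" "norm z < 1"
  shows "summable (\<lambda>l. norm (z ^ l / qpoch q q l))"
proof -
  obtain r where r: "norm z < r" "r < 1" using assms(2) dense by blast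
  have "(\<lambda>n. q ^ n) \<longlonglongrightarrow> 0" using assms(1) by (rule LIMSEQ_power_zero)
  then have "(\<lambda>n. norm (z / (1 - q * q ^ n))) \<longlonglongrightarrow> norm (z / (1 - q * 0))"
    by (intro tendsto_intros) (auto simp: assms)
  then have "\<forall>\<^sub>F n in sequentially. norm (z / (1 - q * q ^ n)) < r"
    using r(1) by (intro order_tendstoD) auto
  then obtain N where N: "\<And>n. n \<ge> N \<Longrightarrow> norm (z / (1 - q * q ^ n)) < r"
    by (auto simp: eventually_sequentially)
  show ?thesis
  proof (rule summable_ratio_test[where c = r and N = N])
    fix n assume n: "n \<ge> N"
    have "z ^ Suc n / qpoch q q (Suc n) = z / (1 - q * q ^ n) * (z ^ n / qpoch q q n)"
      by (simp add: qpoch_Suc)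
    then have "norm (z ^ Suc n / qpoch q q (Suc n))
        = norm (z / (1 - q * q ^ n)) * norm (z ^ n / qpoch q q n)"
      by (simp only: norm_mult)
    also have "\<dots> \<le> r * norm (z ^ n / qpoch q q n)"
      using N[OF n] by (intro mult_right_mono) auto
    finally show "norm (norm (z ^ Suc n / qpoch q q (Suc n)))
        \<le> r * norm (norm (z ^ n / qpoch q q n))"
      by (simp only: real_norm_def abs_norm_cancel)
  qed (rule r(2))
qed

text \<open>
  The sum \<open>E z\<close> satisfies \<open>E (q z) = (1 - z) E z\<close>, because \<open>1 - q\<^sup>l\<close> cancels the last factor of
  \<open>(q;q)\<^sub>l\<close>. Iterating, \<open>(z;q)\<^sub>n E z = E (z q\<^sup>n)\<close>, and this tends to \<open>E 0 = 1\<close> by continuity of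
  the power series.
\<close>

lemma euler_identity:
  assumes "norm q < 1" "norm z < 1"
  shows "(\<Sum>l. z ^ l / qpoch q q l) * qpoch_inf z q = 1"
proof -
  define E where "E w = (\<Sum>l. w ^ l / qpoch q q l)" for w
  have nz: "qpoch q q n \<noteq> 0" for n using qpoch_nonzero assms(1) by blast
  have summ: "summable (\<lambda>l. w ^ l / qpoch q q l)" if "norm w < 1" for w
    using euler_summable_norm[OF assms(1) that] by (rule summable_norm_cancel)
  have small: "norm (z * q ^ n) < 1" for n
  proof -
    have "norm (z * q ^ n) \<le> norm z * 1"
      unfolding norm_mult norm_power using assms(1)
      by (intro mult_left_mono power_le_one) auto
    then show ?thesis using assms(2) by simp
  qed
  have step: "E (w * q) = (1 - w) * E w" if w: "norm w < 1" for w
  proof -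
    have wq: "norm (w * q) < 1"
      using mult_strict_mono'[OF w assms(1)] by (simp add: norm_mult)
    have "E w - E (w * q) = (\<Sum>l. w ^ l / qpoch q q l - (w * q) ^ l / qpoch q q l)"
      unfolding E_def by (rule suminf_diff[OF summ[OF w] summ[OF wq]])
    also have "\<dots> = (\<Sum>l. w ^ Suc l / qpoch q q (Suc l) - (w * q) ^ Suc l / qpoch q q (Suc l))"
      using suminf_split_head[OF summable_diff[OF summ[OF w] summ[OF wq]]] by simp
    also have "\<dots> = (\<Sum>l. w * (w ^ l / qpoch q q l))"
    proof (rule suminf_cong)
      fix l
      have "1 - q * q ^ l \<noteq> 0" using nz[of "Suc l"] by (simp add: qpoch_Suc)
      moreover have "w ^ Suc l - (w * q) ^ Suc l = w * w ^ l * (1 - q * q ^ l)"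
        by (simp add: power_mult_distrib algebra_simps)
      ultimately show "w ^ Suc l / qpoch q q (Suc l) - (w * q) ^ Suc l / qpoch q q (Suc l)
          = w * (w ^ l / qpoch q q l)"
        unfolding qpoch_Suc diff_divide_distrib[symmetric] by simp
    qed
    also have "\<dots> = w * E w" unfolding E_def by (rule suminf_mult[OF summ[OF w]])
    finally show ?thesis by (simp add: algebra_simps)
  qed
  have iter: "E (z * q ^ n) = qpoch z q n * E z" for n
  proof (induction n)
    case (Suc n)
    then show ?case using step[OF small[of n]] by (simp add: qpoch_Suc mult_ac)
  qed simp
  have E_powser: "E = (\<lambda>w. \<Sum>l. inverse (qpoch q q l) * w ^ l)"
    unfolding E_def divide_inverse by (simp only: mult.commute)
  have "summable (\<lambda>l. inverse (qpoch q q l) * (1 / 2) ^ l)"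
    using summ[of "1 / 2"] unfolding divide_inverse[of _ "qpoch q q _"]
    by (simp add: mult.commute)
  then have "isCont E 0"
    unfolding E_powser by (rule isCont_powser) simp
  moreover have "(\<lambda>n. z * q ^ n) \<longlonglongrightarrow> 0"
    by (rule tendsto_mult_right_zero[OF LIMSEQ_power_zero[OF assms(1)]])
  ultimately have "(\<lambda>n. E (z * q ^ n)) \<longlonglongrightarrow> E 0"
    by (rule isCont_tendsto_compose)
  moreover have "E 0 = 1"
    unfolding E_powser by (subst powser_zero) simp
  moreover have "(\<lambda>n. E (z * q ^ n)) \<longlonglongrightarrow> qpoch_inf z q * E z"
    unfolding iter by (intro tendsto_mult tendsto_const qpoch_tendsto_qpoch_inf[OF assms(1)])
  ultimately have "qpoch_inf z q * E z = 1" using LIMSEQ_unique by metis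
  then show ?thesis by (simp add: E_def mult.commute)
qed

section \<open>Coefficients of the Cauchy polynomials\<close>

definition cauchy_coeff :: "complex \<Rightarrow> complex \<Rightarrow> nat \<Rightarrow> complex" where
  "cauchy_coeff a q j = (-1) ^ j * q ^ (j * (j - 1) div 2) * qpoch a q j"

lemma cauchy_poly_eq_qbinom_sum:
  "cauchy_poly q n x y a = qbinom_sum q n (\<lambda>i j. cauchy_coeff a q i * y ^ i * x ^ j)"
  by (simp add: cauchy_poly_def qbinom_sum_def cauchy_coeff_def mult_ac)

lemma triangular_Suc: "Suc n * (Suc n - 1) div 2 = n * (n - 1) div 2 + n"
  by (cases n) (simp_all add: algebra_simps)

lemma triangular_add:
  "(i + m) * (i + m - 1) div 2 = i * (i - 1) div 2 + m * (m - 1) div 2 + i * (m :: nat)"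
proof (induction m)
  case (Suc m)
  then show ?case using triangular_Suc[of "i + m"] triangular_Suc[of m] by simp
qed simp

lemma cauchy_coeff_add:
  "cauchy_coeff a q (i + m) * w ^ m / qpoch q q m
    = cauchy_coeff a q i * phi11_term (a * q ^ i) q (w * q ^ i) m"
  unfolding cauchy_coeff_def phi11_term_def triangular_add qpoch_add
  by (simp add: power_add power_mult power_mult_distrib mult_ac)

text \<open>
  Absolute convergence comes for free: the series is a power series in \<open>z\<close> that converges
  for every \<open>z\<close>.
\<close>

lemma summable_norm_phi11_term:
  assumes "norm q < 1"
  shows "summable (\<lambda>n. norm (phi11_term a q z n))"
proof -
  define f where "f n = (-1) ^ n * q ^ (n * (n - 1) div 2) * (qpoch a q n / qpoch q q n)" for n
  have f: "phi11_term a q w = (\<lambda>n. f n * w ^ n)" for w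
    by (simp add: phi11_term_def f_def fun_eq_iff)
  have "summable (\<lambda>n. f n * of_real (norm z + 1) ^ n)"
    using summable_phi11_term[OF assms, of a "of_real (norm z + 1)"] by (simp add: f)
  moreover have "norm z < norm (of_real (norm z + 1) :: complex)"
    by (simp only: norm_of_real)
  ultimately show ?thesis unfolding f by (rule powser_insidea)
qed

text \<open>
  Each factor of \<open>(q\<^bsup>-k\<^esup>;q)\<^sub>i\<close> contributes \<open>q\<^sup>k (1 - q\<^bsup>j-k\<^esup>) = - q\<^sup>j (1 - q\<^bsup>k-j\<^esup>)\<close>, which
  yields the sign, the triangular power of \<open>q\<close>, and the top factors of \<open>(q;q)\<^sub>k\<close>.
\<close>

lemma qpoch_neg_power:
  assumes "0 < norm q" "norm q < 1" "i \<le> k"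
  shows "qpoch (q powi (- int k)) q i * (q ^ k) ^ i / qpoch q q i
    = (-1) ^ i * q ^ (i * (i - 1) div 2) * qbinom q k i"
proof -
  have nz: "qpoch q q n \<noteq> 0" for n using qpoch_nonzero assms by blast
  have q0: "q \<noteq> 0" using assms(1) by auto
  have "qpoch (q powi (- int k)) q i * (q ^ k) ^ i * qpoch q q (k - i)
      = (-1) ^ i * q ^ (i * (i - 1) div 2) * qpoch q q k"
    using assms(3)
  proof (induction i)
    case 0
    then show ?case by simp
  next
    case (Suc i)
    define d where "d = k - Suc i"
    have d: "k - i = Suc d" "k - Suc i = d" "k = i + Suc d" using Suc.prems by (auto simp: d_def)
    have "q powi (- int k) * q ^ k = 1"
      using q0 by (simp add: power_int_minus)
    then have "(1 - q powi (- int k) * q ^ i) * q ^ k = q ^ k - q ^ i"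
      by (simp add: algebra_simps)
    also have "\<dots> = - (q ^ i * (1 - q * q ^ d))"
      by (simp add: d(3) power_add algebra_simps)
    finally have fac: "(1 - q powi (- int k) * q ^ i) * q ^ k = - (q ^ i * (1 - q * q ^ d))" .
    have "qpoch (q powi (- int k)) q (Suc i) * (q ^ k) ^ Suc i * qpoch q q (k - Suc i)
        = qpoch (q powi (- int k)) q i * (q ^ k) ^ i * qpoch q q d
          * ((1 - q powi (- int k) * q ^ i) * q ^ k)"
      by (simp only: d(2) qpoch_Suc power_Suc mult_ac)
    also have "\<dots> = - (q ^ i) * (qpoch (q powi (- int k)) q i * (q ^ k) ^ i * qpoch q q (k - i))"
      unfolding fac d(1) qpoch_Suc by (simp add: mult_ac)
    also have "\<dots> = - (q ^ i) * ((-1) ^ i * q ^ (i * (i - 1) div 2) * qpoch q q k)"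
      using Suc by simp
    finally show ?case unfolding triangular_Suc by (simp add: power_add mult_ac)
  qed
  then show ?thesis using nz by (simp add: qbinom_def field_simps)
qed

lemma qpoch_neg_power_eq_0:
  assumes "q \<noteq> 0" "k < i"
  shows "qpoch (q powi (- int k)) q i = 0"
  using assms by (auto simp: qpoch_def power_int_minus intro!: bexI[of _ k])

section \<open>The generating function\<close>

text \<open>
  A single term of the \<open>q\<close>-Vandermonde decomposition has a product as its generating
  function; \<open>i\<close> stands for the shift.
\<close>

lemma shifted_generating_function:
  assumes "norm q < 1" "norm (x * t) < 1"
  shows "(\<lambda>n. qbinom_sum q n (\<lambda>m l. cauchy_coeff a q (i + m) * y ^ m * (x * q ^ i) ^ l)
              * (t ^ n / qpoch q q n))
    sums (cauchy_coeff a q i * phi11 (a * q ^ i) q (y * t * q ^ i)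
          * (qpoch (x * t) q i / qpoch_inf (x * t) q))"
proof -
  define u where "u m = cauchy_coeff a q (i + m) * (y * t) ^ m" for m
  define v where "v l = (x * t * q ^ i) ^ l" for l
  have u: "u m / qpoch q q m = cauchy_coeff a q i * phi11_term (a * q ^ i) q (y * t * q ^ i) m" for m
    unfolding u_def by (rule cauchy_coeff_add)
  have small: "norm (x * t * q ^ i) < 1"
  proof -
    have "norm (x * t * q ^ i) \<le> norm (x * t) * 1"
      unfolding norm_mult[of "x * t"] norm_power using assms(1)
      by (intro mult_left_mono power_le_one) auto
    then show ?thesis using assms(2) by simp
  qed
  have su: "summable (\<lambda>m. norm (u m / qpoch q q m))"
    unfolding u norm_mult[of "cauchy_coeff a q i"]
    by (intro summable_mult summable_norm_phi11_term assms)
  have sv: "summable (\<lambda>l. norm (v l / qpoch q q l))"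
    unfolding v_def by (rule euler_summable_norm[OF assms(1) small])
  have uv: "qbinom_sum q n (\<lambda>m l. u m * v l)
      = qbinom_sum q n (\<lambda>m l. cauchy_coeff a q (i + m) * y ^ m * (x * q ^ i) ^ l) * t ^ n" for n
    unfolding qbinom_sum_def sum_distrib_right
  proof (intro sum.cong refl)
    fix m assume "m \<in> {..n}"
    then have "t ^ n = t ^ m * t ^ (n - m)" by (simp flip: power_add)
    then show "qbinom q n m * (u m * v (n - m)) =
        qbinom q n m * (cauchy_coeff a q (i + m) * y ^ m * (x * q ^ i) ^ (n - m)) * t ^ n"
      by (simp add: u_def v_def power_mult_distrib mult_ac)
  qed
  have "(\<Sum>m. u m / qpoch q q m) = cauchy_coeff a q i * phi11 (a * q ^ i) q (y * t * q ^ i)"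
    unfolding u phi11_def by (intro suminf_mult summable_phi11_term assms)
  moreover have "(\<Sum>l. v l / qpoch q q l) = qpoch (x * t) q i / qpoch_inf (x * t) q"
  proof -
    have "(\<Sum>l. v l / qpoch q q l) * qpoch_inf (x * t * q ^ i) q = 1"
      unfolding v_def by (rule euler_identity[OF assms(1) small])
    then have "(\<Sum>l. v l / qpoch q q l) * qpoch_inf (x * t) q = qpoch (x * t) q i"
      unfolding qpoch_inf_split[OF assms(1), of "x * t" i]
      by (metis mult.left_commute mult.right_neutral)
    moreover have "qpoch_inf (x * t) q \<noteq> 0"
      using euler_identity[OF assms] by auto
    ultimately show ?thesis by (simp add: field_simps)
  qed
  ultimately show ?thesis
    using qbinom_sum_product_sums[OF assms(1) su sv] by (simp add: uv)
qed

theorem theorem3p2: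
  fixes q a x y t :: complex and k :: nat
  assumes "0 < norm q" and "norm q < 1"
    and "x \<noteq> 0"
    and "norm (x * t) < 1"
  shows "summable (\<lambda>n. qpochs [q powi (- int k), x * t, a] q n * (y * inverse x * q ^ k) ^ n
                        / qpoch q q n * phi11 (a * q ^ n) q (y * t * q ^ n))
    \<and> (\<lambda>n. cauchy_poly q (n + k) x y a * (t ^ n / qpoch q q n)) sums
           (x ^ k / qpoch_inf (x * t) q *
             (\<Sum>n. qpochs [q powi (- int k), x * t, a] q n * (y * inverse x * q ^ k) ^ n
                    / qpoch q q n * phi11 (a * q ^ n) q (y * t * q ^ n)))"
proof -
  define R where "R n = qpochs [q powi (- int k), x * t, a] q n * (y * inverse x * q ^ k) ^ n
    / qpoch q q n * phi11 (a * q ^ n) q (y * t * q ^ n)" for n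
  define S where "S i n = qbinom_sum q n
    (\<lambda>m l. cauchy_coeff a q (i + m) * y ^ m * (x * q ^ i) ^ l)" for i n
  define G where "G i = cauchy_coeff a q i * phi11 (a * q ^ i) q (y * t * q ^ i)
    * (qpoch (x * t) q i / qpoch_inf (x * t) q)" for i
  have "R sums (\<Sum>i\<le>k. R i)"
  proof (rule sums_finite)
    fix n assume "n \<notin> {..k}"
    then show "R n = 0"
      using qpoch_neg_power_eq_0[of q k n] assms(1) by (simp add: R_def qpochs_def)
  qed simp
  then have R: "summable R" "suminf R = (\<Sum>i\<le>k. R i)"
    by (auto simp: sums_iff)
  have split: "cauchy_poly q (n + k) x y a * (t ^ n / qpoch q q n)
      = (\<Sum>i\<le>k. qbinom q k i * (x ^ (k - i) * y ^ i) * (S i n * (t ^ n / qpoch q q n)))" for n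
  proof -
    have "cauchy_poly q (n + k) x y a = qbinom_sum q k (\<lambda>i j. x ^ j * y ^ i * S i n)"
      unfolding cauchy_poly_eq_qbinom_sum qbinom_sum_add[OF assms(2)] S_def
        qbinom_sum_cmult[symmetric]
      by (simp add: power_add power_mult_distrib power_mult mult_ac)
    then show ?thesis
      by (simp only: qbinom_sum_def sum_distrib_right mult.assoc)
  qed
  have "(\<lambda>n. cauchy_poly q (n + k) x y a * (t ^ n / qpoch q q n)) sums
      (\<Sum>i\<le>k. qbinom q k i * (x ^ (k - i) * y ^ i) * G i)"
    unfolding split S_def G_def
    by (intro sums_sum sums_mult shifted_generating_function assms(2,4))
  also have "(\<Sum>i\<le>k. qbinom q k i * (x ^ (k - i) * y ^ i) * G i)
      = x ^ k / qpoch_inf (x * t) q * (\<Sum>i\<le>k. R i)"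
    unfolding sum_distrib_left
  proof (intro sum.cong refl)
    fix i assume "i \<in> {..k}"
    then have i: "i \<le> k" by simp
    have x: "x ^ k * inverse x ^ i = x ^ (k - i)"
      using i assms(3) by (simp add: power_diff power_inverse divide_inverse)
    have "x ^ k / qpoch_inf (x * t) q * R i
        = (qpoch (q powi (- int k)) q i * (q ^ k) ^ i / qpoch q q i) * (x ^ k * inverse x ^ i)
          * y ^ i * qpoch a q i * phi11 (a * q ^ i) q (y * t * q ^ i)
          * (qpoch (x * t) q i / qpoch_inf (x * t) q)"
      by (simp add: R_def qpochs_def power_mult_distrib mult_ac)
    also have "\<dots> = qbinom q k i * (x ^ (k - i) * y ^ i) * G i"
      unfolding qpoch_neg_power[OF assms(1,2) i] x G_def cauchy_coeff_def by (simp add: mult_ac)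
    finally show "qbinom q k i * (x ^ (k - i) * y ^ i) * G i
      = x ^ k / qpoch_inf (x * t) q * R i" by simp
  qed
  finally show ?thesis using R unfolding R_def by simp
qed

end
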